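(* Let $m\ge1$ and let $R_m=\overline{\mathrm{R}}(\mathfrak{B}_m)$. For all integers $R_m\le t\le n$, $$\overline{\mathrm{M}}(n;\mathfrak{B}_m,\mathfrak{B}_m)\ \ge\ \overline{\mathrm{M}}(t;\mathfrak{B}_m,\mathfrak{B}_m)\,\frac{\binom{n}{2m}}{\binom{t}{2m}}.$$ Moreover, $$\overline{\mathrm{M}}(n;\mathfrak{B}_m,\mathfrak{B}_m)\ \le\ \binom{n}{2m}\frac{(2m-2)!}{2^{2m-2}(m-1)!}.$$ Therefore the sequence $\overline{\mathrm{M}}(n;\mathfrak{B}_m,\mathfrak{B}_m)/\binom{n}{2m}$, $n\ge R_m$, is nondecreasing and converges to a density $\pi(\mathfrak{B}_m)$ satisfying $$\frac{\overline{\mathrm{M}}(R_m;\mathfrak{B}_m,\mathfrak{B}_m)}{\binom{R_m}{2m}}\ \le\ \pi(\mathfrak{B}_m)\ \le\ \frac{(2m-2)!}{2^{2m-2}(m-1)!}.$$ In particular, $\overline{\mathrm{M}}(n;\mathfrak{B}_m,\mathfrak{B}_m)=\Theta(n^{2m})$ as $n\to\infty$ for fixed $m$.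
   Context: An ordered graph is a finite graph with a linear order on its vertex set. $\mathcal{K}_n$ is the complete graph on $[n]=\{1,\ldots,n\}$ with the natural order. An order-preserving copy of an ordered graph $\mathcal{H}$ in $\mathcal{G}$ is an injective map $V(\mathcal{H})\to V(\mathcal{G})$ that preserves the vertex order and maps every edge of $\mathcal{H}$ to an edge of $\mathcal{G}$. For $m\ge1$, $\mathfrak{B}_m$ is the family of all ordered perfect matchings on the vertex set $[2m]$ (with its natural order) that contain the edge $\{1,2m\}$. $\overline{\mathrm{R}}(\mathfrak{B}_m)$ is the least $N$ such that every red--blue edge-coloring of $\mathcal{K}_N$ contains a monochromatic order-preserving copy of some member of $\mathfrak{B}_m$. $\overline{\mathrm{M}}(n;\mathfrak{B}_m,\mathfrak{B}_m)$ denotes the minimum, over all red--blue edge-colorings of $\mathcal{K}_n$, of the total number of monochromatic (red or blue) order-preserving copies of members of $\mathfrak{B}_m$, where copies are counted as pairs consisting of a member of $\mathfrak{B}_m$ and the $2m$-element vertex set on which it is placed. *)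

theory Defs
  imports Complex_Main "HOL-Library.FuncSet" "HOL-Library.Ramsey" "HOL-Library.Landau_Symbols"
begin

text \<open>An ordered graph is a pair of a vertex set and an edge set; the linear order on
  the vertices is the one of the vertex type. Edges are 2-element sets of vertices,
  \<open>nsets V 2\<close> being the set of all of them.\<close>

type_synonym 'a ograph = "'a set \<times> 'a set set"

abbreviation verts :: "'a ograph \<Rightarrow> 'a set" where "verts H \<equiv> fst H"
abbreviation edges :: "'a ograph \<Rightarrow> 'a set set" where "edges H \<equiv> snd H"

definition ordered_graph :: "'a::linorder ograph \<Rightarrow> bool" where
  "ordered_graph H \<longleftrightarrow> finite (verts H) \<and> edges H \<subseteq> nsets (verts H) 2"

definition complete_ograph :: "nat \<Rightarrow> nat ograph" where
  "complete_ograph n = ({1..n}, nsets {1..n} 2)"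

definition op_copy :: "('a::linorder \<Rightarrow> 'b::linorder) \<Rightarrow> 'a ograph \<Rightarrow> 'b ograph \<Rightarrow> bool" where
  "op_copy f H G \<longleftrightarrow>
     f ` verts H \<subseteq> verts G \<and> inj_on f (verts H) \<and> mono_on (verts H) f \<and>
     (\<forall>e\<in>edges H. f ` e \<in> edges G)"

definition perfect_matching :: "'a::linorder ograph \<Rightarrow> bool" where
  "perfect_matching H \<longleftrightarrow> ordered_graph H \<and> (\<forall>v\<in>verts H. \<exists>!e. e \<in> edges H \<and> v \<in> e)"

definition B_family :: "nat \<Rightarrow> nat ograph set" where
  "B_family m = {H. verts H = {1..2*m} \<and> perfect_matching H \<and> {1, 2*m} \<in> edges H}"

datatype colour = Red | Blue

text \<open>Colourings are extensional functions, i.e. functions with the edge set of the complete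
  graph as their domain, so that there are only finitely many of them.\<close>

definition colourings :: "nat \<Rightarrow> (nat set \<Rightarrow> colour) set" where
  "colourings n = edges (complete_ograph n) \<rightarrow>\<^sub>E UNIV"

definition colour_class :: "nat \<Rightarrow> (nat set \<Rightarrow> colour) \<Rightarrow> colour \<Rightarrow> nat ograph" where
  "colour_class n c k =
     (verts (complete_ograph n), {e \<in> edges (complete_ograph n). c e = k})"

definition ordered_Ramsey :: "nat ograph set \<Rightarrow> nat" where
  "ordered_Ramsey F =
     (LEAST N. \<forall>c\<in>colourings N. \<exists>k. \<exists>H\<in>F. \<exists>f. op_copy f H (colour_class N c k))"

text \<open>A copy is recorded as a member of the family together with the vertex set on which it
  is placed (an order-preserving injection of a finite set is determined by its image).\<close>

definition copies :: "nat ograph set \<Rightarrow> nat ograph \<Rightarrow> (nat ograph \<times> nat set) set" where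
  "copies F G = {(H, S). H \<in> F \<and> (\<exists>f. op_copy f H G \<and> f ` verts H = S)}"

definition ordered_mult :: "nat \<Rightarrow> nat ograph set \<Rightarrow> nat ograph set \<Rightarrow> nat" where
  "ordered_mult n F F' =
     Min ((\<lambda>c. card (copies F (colour_class n c Red)) + card (copies F' (colour_class n c Blue)))
            ` colourings n)"

end

theory Submission
  imports Defs
begin

text \<open>Both bounds are averaging arguments. Restricting an optimal colouring of \<open>K\<^sub>n\<close> to every
  \<open>t\<close>-element vertex set and double counting the pairs (copy, \<open>t\<close>-set containing it) gives the
  monotonicity of the density. For the upper bound one averages over all colourings: each of the
  \<open>n choose 2m\<close> positions of each matching is monochromatic with probability \<open>2 / 2\<^sup>m\<close>, and
  deleting the edge \<open>{1, 2m}\<close> shows that there are at most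
  \<open>(2m - 2)! / (2\<^sup>m\<^sup>-\<^sup>1 (m - 1)!)\<close> matchings. Ramsey's theorem makes
  the Ramsey number meaningful (a least element of a nonempty set) and the density at it positive,
  which yields the lower bound in the growth rate.\<close>

section \<open>Colourings and the minimum number of monochromatic copies\<close>

text \<open>The objective function that \<open>ordered_mult\<close> minimises over
  \<open>colourings n\<close>.\<close>

definition mono_copies :: "nat \<Rightarrow> nat ograph set \<Rightarrow> nat ograph set \<Rightarrow> (nat set \<Rightarrow> colour) \<Rightarrow> nat" where
  "mono_copies n F F' c =
     card (copies F (colour_class n c Red)) + card (copies F' (colour_class n c Blue))"

lemma UNIV_colour: "(UNIV :: colour set) = {Red, Blue}"
  using colour.exhaust by auto

lemma finite_colourings: "finite (colourings n)"
  by (simp add: colourings_def complete_ograph_def finite_PiE finite_imp_finite_nsets UNIV_colour)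

lemma card_colourings: "card (colourings n) = 2 ^ (n choose 2)"
  by (simp add: colourings_def complete_ograph_def card_PiE finite_imp_finite_nsets UNIV_colour
      flip: numeral_2_eq_2)

lemma colourings_nonempty: "colourings n \<noteq> {}"
  by (simp add: colourings_def PiE_eq_empty_iff)

lemma ordered_mult_le: "c \<in> colourings n \<Longrightarrow> ordered_mult n F F' \<le> mono_copies n F F' c"
  unfolding ordered_mult_def mono_copies_def
  by (intro Min_le) (auto simp: finite_colourings)

lemma ordered_mult_attained:
  obtains c where "c \<in> colourings n" "ordered_mult n F F' = mono_copies n F F' c"
proof -
  have "ordered_mult n F F' \<in> mono_copies n F F' ` colourings n"
    unfolding ordered_mult_def mono_copies_def
    by (intro Min_in) (auto simp: finite_colourings colourings_nonempty)
  with that show thesis by blast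
qed

section \<open>Copies as increasing enumerations of vertex sets\<close>

text \<open>Between linear orders, injective and weakly monotone together mean strictly monotone;
  this form fits the enumeration lemmas below.\<close>

lemma op_copy_colour_class_iff:
  "op_copy f H (colour_class n c k) \<longleftrightarrow>
     f ` verts H \<subseteq> {1..n} \<and> strict_mono_on (verts H) f \<and>
     (\<forall>e\<in>edges H. f ` e \<in> nsets {1..n} 2 \<and> c (f ` e) = k)"
  unfolding op_copy_def colour_class_def complete_ograph_def
  by (auto simp: strict_mono_iff_mono)

text \<open>A strictly increasing map is injective, so its image has exactly \<open>k\<close>
  elements. This yields finiteness of the set of copies and the size of every recorded vertex
  set.\<close>

lemma copies_subset:
  assumes "\<And>H. H \<in> F \<Longrightarrow> verts H = {1..k}"
  shows "copies F (colour_class n c r) \<subseteq> F \<times> nsets {1..n} k"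
proof
  fix p assume "p \<in> copies F (colour_class n c r)"
  then obtain H f where p: "p = (H, f ` verts H)" "H \<in> F" "op_copy f H (colour_class n c r)"
    by (auto simp: copies_def)
  with assms show "p \<in> F \<times> nsets {1..n} k"
    by (auto simp: op_copy_colour_class_iff nsets_def card_image strict_mono_on_imp_inj_on)
qed

lemma obtain_enumeration:
  fixes S :: "nat set"
  assumes "finite S"
  obtains f where "strict_mono_on {1..card S} f" "f ` {1..card S} = S"
proof -
  obtain h where h: "bij_betw h {..<card S} S" "strict_mono_on {..<card S} h"
    using ex_bij_betw_strict_mono_card[OF assms] by blast
  \<comment> \<open>Enumerations from the library start at 0, vertex sets at 1; the index shift
    reconciles them.\<close>
  have im: "(\<lambda>i. i - 1) ` {1..card S} = {..<card S}"
    by (auto simp: image_iff intro!: bexI[of _ "Suc _"])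
  show thesis
  proof (rule that[of "\<lambda>i. h (i - 1)"])
    show "strict_mono_on {1..card S} (\<lambda>i. h (i - 1))"
    proof (rule strict_mono_onI)
      fix i j assume "i \<in> {1..card S}" "j \<in> {1..card S}" "i < j"
      then show "h (i - 1) < h (j - 1)"
        by (intro strict_mono_onD[OF h(2)]) auto
    qed
    have "(\<lambda>i. h (i - 1)) ` {1..card S} = h ` ((\<lambda>i. i - 1) ` {1..card S})"
      by (simp add: image_image)
    then show "(\<lambda>i. h (i - 1)) ` {1..card S} = S"
      unfolding im using h(1) by (simp add: bij_betw_def)
  qed
qed

text \<open>Both maps list the same set in increasing order, and a strictly sorted list is
  determined by its set. Hence a copy is determined by its member of the family and its vertex
  set.\<close>

lemma enumeration_unique:
  fixes f g :: "nat \<Rightarrow> nat"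
  assumes "strict_mono_on {1..k} f" "strict_mono_on {1..k} g" "f ` {1..k} = g ` {1..k}"
    and "i \<in> {1..k}"
  shows "f i = g i"
proof -
  have *: "sorted_wrt (<) (map h [1..<Suc k])" if "strict_mono_on {1..k} h" for h :: "nat \<Rightarrow> nat"
    using that by (auto simp: sorted_wrt_iff_nth_less strict_mono_on_def simp del: upt_Suc)
  have "map f [1..<Suc k] = map g [1..<Suc k]"
    using assms(3) by (intro strict_sorted_equal * assms(1,2))
      (simp add: atLeastLessThanSuc_atLeastAtMost del: upt_Suc)
  with assms(4) show ?thesis
    by (auto simp del: upt_Suc)
qed

section \<open>Double counting over \<open>t\<close>-element vertex sets and monotonicity of the
  density\<close>

lemma card_supersets:
  assumes "finite A" "S \<subseteq> A" "card S \<le> t"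
  shows "card {T \<in> nsets A t. S \<subseteq> T} = (card A - card S) choose (t - card S)"
proof -
  have fS: "finite S" using assms finite_subset by blast
  have "bij_betw (\<lambda>T. T - S) {T \<in> nsets A t. S \<subseteq> T} (nsets (A - S) (t - card S))"
  proof (rule bij_betw_byWitness[where f' = "\<lambda>U. U \<union> S"])
    show "(\<lambda>T. T - S) ` {T \<in> nsets A t. S \<subseteq> T} \<subseteq> nsets (A - S) (t - card S)"
      using fS by (auto simp: nsets_def card_Diff_subset)
    have "card (U \<union> S) = t" if "U \<subseteq> A - S" "finite U" "card U = t - card S" for U
      using that assms fS by (subst card_Un_disjoint) auto
    then show "(\<lambda>U. U \<union> S) ` nsets (A - S) (t - card S) \<subseteq> {T \<in> nsets A t. S \<subseteq> T}"
      using fS assms by (auto simp: nsets_def)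
  qed (auto simp: nsets_def)
  then show ?thesis
    using assms fS by (simp add: bij_betw_same_card card_Diff_subset)
qed

text \<open>Pulling a colouring back along the enumeration of \<open>T\<close> identifies the copies in the
  pulled-back colouring with the copies inside \<open>T\<close>.\<close>

lemma pullback_colouring:
  assumes c: "c \<in> colourings n" and T: "T \<in> nsets {1..n} t"
  obtains c' where "c' \<in> colourings t"
    and "\<And>F k r. (\<And>H. H \<in> F \<Longrightarrow> verts H = {1..k} \<and> edges H \<subseteq> nsets {1..k} 2) \<Longrightarrow> finite F \<Longrightarrow>
       card (copies F (colour_class t c' r))
         \<le> card {(H, S) \<in> copies F (colour_class n c r). S \<subseteq> T}"
proof -
  have T': "finite T" "card T = t" "T \<subseteq> {1..n}" using T by (auto simp: nsets_def)
  obtain g where g: "strict_mono_on {1..t} g" "g ` {1..t} = T"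
    using obtain_enumeration[OF T'(1)] T'(2) by metis
  have inj: "inj_on g {1..t}" using g(1) by (rule strict_mono_on_imp_inj_on)
  \<comment> \<open>The edge joining \<open>i\<close> and \<open>j\<close> gets the colour of the
    edge joining \<open>g i\<close> and \<open>g j\<close>; \<open>restrict\<close> provides the
    extensionality that \<open>colourings\<close> demands.\<close>
  define c' where "c' = restrict (\<lambda>e. c (g ` e)) (nsets {1..t} 2)"
  show thesis
  proof (rule that)
    show "c' \<in> colourings t"
      by (simp add: c'_def colourings_def complete_ograph_def)
    fix F :: "nat ograph set" and k r
    assume F: "\<And>H. H \<in> F \<Longrightarrow> verts H = {1..k} \<and> edges H \<subseteq> nsets {1..k} 2" and fin: "finite F"
    have sub: "copies F (colour_class j d r) \<subseteq> F \<times> nsets {1..j} k" for j d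
      using F by (intro copies_subset) auto
    show "card (copies F (colour_class t c' r))
            \<le> card {(H, S) \<in> copies F (colour_class n c r). S \<subseteq> T}"
    proof (rule card_inj_on_le[where f = "\<lambda>(H, S). (H, g ` S)"])
      show "inj_on (\<lambda>(H, S). (H, g ` S)) (copies F (colour_class t c' r))"
      proof (rule inj_onI)
        fix p p' assume "p \<in> copies F (colour_class t c' r)" "p' \<in> copies F (colour_class t c' r)"
          and eq: "(\<lambda>(H, S). (H, g ` S)) p = (\<lambda>(H, S). (H, g ` S)) p'"
        with sub[of t c'] have "snd p \<in> nsets {1..t} k" "snd p' \<in> nsets {1..t} k"
          by auto
        with eq show "p = p'"
          using inj_onD[OF inj_on_nsets[OF inj, of k], of "snd p" "snd p'"]
          by (auto simp: case_prod_beta prod_eq_iff)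
      qed
      have "finite (copies F (colour_class n c r))"
        by (rule finite_subset[OF sub]) (simp add: fin finite_imp_finite_nsets)
      then show "finite {(H, S) \<in> copies F (colour_class n c r). S \<subseteq> T}"
        by (rule rev_finite_subset) auto
      show "(\<lambda>(H, S). (H, g ` S)) ` copies F (colour_class t c' r)
              \<subseteq> {(H, S) \<in> copies F (colour_class n c r). S \<subseteq> T}"
      proof clarify
        fix H S assume "(H, S) \<in> copies F (colour_class t c' r)"
        then obtain f where H: "H \<in> F" and f: "op_copy f H (colour_class t c' r)" "S = f ` verts H"
          by (auto simp: copies_def)
        have fe: "f ` verts H \<subseteq> {1..t}" "strict_mono_on (verts H) f"
          "\<And>e. e \<in> edges H \<Longrightarrow> f ` e \<in> nsets {1..t} 2 \<and> c (g ` f ` e) = r"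
          using f(1) by (auto simp: op_copy_colour_class_iff c'_def)
        have "g ` f ` e \<in> nsets {1..n} 2" if "e \<in> edges H" for e
        proof -
          have *: "f ` e \<subseteq> {1..t}" "card (f ` e) = 2" "finite (f ` e)"
            using fe(3)[OF that] by (auto simp: nsets_def)
          then have "card (g ` f ` e) = 2"
            using inj by (metis card_image inj_on_subset)
          with * g(2) T'(3) show ?thesis
            unfolding nsets_def by blast
        qed
        moreover have "strict_mono_on (verts H) (g \<circ> f)"
        proof (rule strict_mono_onI)
          fix i j assume "i \<in> verts H" "j \<in> verts H" "i < j"
          with fe(1) strict_mono_onD[OF fe(2)] show "(g \<circ> f) i < (g \<circ> f) j"
            by (auto intro!: strict_mono_onD[OF g(1)])
        qed
        ultimately have "op_copy (g \<circ> f) H (colour_class n c r)"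
          using fe g(2) T'(3) unfolding op_copy_colour_class_iff image_comp[symmetric]
          by blast
        moreover have "(g \<circ> f) ` verts H = g ` S"
          unfolding f(2) image_comp ..
        ultimately have "(H, g ` S) \<in> copies F (colour_class n c r)"
          using H unfolding copies_def by blast
        moreover have "g ` S \<subseteq> T"
          using fe(1) g(2) f(2) by blast
        ultimately show "(H, g ` S) \<in> copies F (colour_class n c r) \<and> g ` S \<subseteq> T" ..
      qed
    qed
  qed
qed

text \<open>A copy occupies \<open>k\<close> vertices, so exactly
  \<open>(n - k) choose (t - k)\<close> of the \<open>t\<close>-sets contain it, whichever copy it
  is.\<close>

lemma sum_card_copies_inside:
  assumes F: "\<And>H. H \<in> F \<Longrightarrow> verts H = {1..k}" and fin: "finite F" and "k \<le> t"
  shows "(\<Sum>T\<in>nsets {1..n} t. card {(H, S) \<in> copies F (colour_class n c r). S \<subseteq> T})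
           = card (copies F (colour_class n c r)) * ((n - k) choose (t - k))"
proof -
  let ?C = "copies F (colour_class n c r)"
  have sub: "?C \<subseteq> F \<times> nsets {1..n} k"
    using F by (rule copies_subset)
  then have "finite ?C"
    by (rule finite_subset) (simp add: fin finite_imp_finite_nsets)
  then have "(\<Sum>T\<in>nsets {1..n} t. card {p \<in> ?C. snd p \<subseteq> T}) = ((n - k) choose (t - k)) * card ?C"
  proof (intro sum_multicount ballI)
    fix p assume "p \<in> ?C"
    with sub have "snd p \<in> nsets {1..n} k" by auto
    then have S: "snd p \<subseteq> {1..n}" "card (snd p) = k"
      by (auto simp: nsets_def)
    show "card {T \<in> nsets {1..n} t. snd p \<subseteq> T} = (n - k) choose (t - k)"
      using card_supersets[of "{1..n}" "snd p" t] S \<open>k \<le> t\<close> by simp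
  qed (simp_all add: finite_imp_finite_nsets)
  moreover have "{(H, S) \<in> ?C. S \<subseteq> T} = {p \<in> ?C. snd p \<subseteq> T}" for T
    by auto
  ultimately show ?thesis by (simp add: mult.commute)
qed

text \<open>An optimal colouring on \<open>n\<close> vertices, pulled back to any
  \<open>t\<close>-set, still has at least \<open>ordered_mult t F F'\<close> copies. Summing over
  all \<open>t\<close>-sets counts each copy \<open>(n - k) choose (t - k)\<close> times.\<close>

lemma ordered_mult_averaging:
  assumes F: "\<And>H. H \<in> F \<union> F' \<Longrightarrow> verts H = {1..k} \<and> edges H \<subseteq> nsets {1..k} 2"
    and fin: "finite F" "finite F'" and "k \<le> t"
  shows "(n choose t) * ordered_mult t F F' \<le> ordered_mult n F F' * ((n - k) choose (t - k))"
proof -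
  obtain c where c: "c \<in> colourings n" "ordered_mult n F F' = mono_copies n F F' c"
    by (rule ordered_mult_attained)
  let ?in = "\<lambda>F r T. card {(H, S) \<in> copies F (colour_class n c r). S \<subseteq> T}"
  have "ordered_mult t F F' \<le> ?in F Red T + ?in F' Blue T" if T: "T \<in> nsets {1..n} t" for T
  proof -
    \<comment> \<open>One pulled-back colouring has to serve both colours at once, so its property
      stays quantified over \<open>F\<close>, \<open>k\<close> and \<open>r\<close>.\<close>
    obtain c' where c': "c' \<in> colourings t"
      "\<And>F k r. (\<And>H. H \<in> F \<Longrightarrow> verts H = {1..k} \<and> edges H \<subseteq> nsets {1..k} 2) \<Longrightarrow> finite F \<Longrightarrow>
         card (copies F (colour_class t c' r)) \<le> ?in F r T"
      by (rule pullback_colouring[OF c(1) T]) blast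
    have "mono_copies t F F' c' \<le> ?in F Red T + ?in F' Blue T"
      unfolding mono_copies_def using F fin by (intro add_mono c'(2)[of _ k]) auto
    with ordered_mult_le[OF c'(1), of F F'] show ?thesis by linarith
  qed
  then have "(\<Sum>T\<in>nsets {1..n} t. ordered_mult t F F')
      \<le> (\<Sum>T\<in>nsets {1..n} t. ?in F Red T + ?in F' Blue T)"
    by (rule sum_mono)
  also have "\<dots> = mono_copies n F F' c * ((n - k) choose (t - k))"
    unfolding sum.distrib mono_copies_def add_mult_distrib
    using F fin \<open>k \<le> t\<close> by (intro arg_cong2[where f = "(+)"] sum_card_copies_inside) auto
  finally show ?thesis
    using c(2) by simp
qed

text \<open>The averaging bound is combined with \<open>(n choose k) * ((n - k) choose (t - k)) = (n
  choose t) * (t choose k)\<close>; then \<open>n choose t\<close>, positive because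
  \<open>t \<le> n\<close>, cancels.\<close>

lemma ordered_mult_density_mono:
  assumes F: "\<And>H. H \<in> F \<union> F' \<Longrightarrow> verts H = {1..k} \<and> edges H \<subseteq> nsets {1..k} 2"
    and fin: "finite F" "finite F'" and "k \<le> t" "t \<le> n"
  shows "real (ordered_mult t F F') / real (t choose k) \<le> real (ordered_mult n F F') / real (n choose k)"
proof -
  have pos: "0 < t choose k" "0 < n choose k" "0 < (n choose t)"
    using assms by (auto intro!: zero_less_binomial)
  have "real (n choose t) * (real (ordered_mult t F F') * real (n choose k))
      \<le> real (ordered_mult n F F') * (real (n choose k) * real ((n - k) choose (t - k)))"
    using mult_left_mono[OF ordered_mult_averaging[OF F fin \<open>k \<le> t\<close>, of n], of "n choose k"]
    by (simp only: of_nat_mult[symmetric] of_nat_le_iff mult_ac)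
  also have "real (n choose k) * real ((n - k) choose (t - k)) = real (n choose t) * real (t choose k)"
    using choose_mult[OF \<open>k \<le> t\<close> \<open>t \<le> n\<close>] by (metis of_nat_mult)
  finally have "real (ordered_mult t F F') * real (n choose k)
      \<le> real (ordered_mult n F F') * real (t choose k)"
    using pos by (simp add: mult.left_commute)
  with pos show ?thesis by (simp add: field_simps)
qed

section \<open>Averaging over all colourings\<close>

lemma card_colourings_constant_on:
  assumes "D \<subseteq> nsets {1..n} 2"
  shows "card {c \<in> colourings n. \<forall>e\<in>D. c e = r} = 2 ^ ((n choose 2) - card D)"
proof -
  let ?E = "nsets {1..n} 2"
  have fin: "finite ?E" by (simp add: finite_imp_finite_nsets)
  \<comment> \<open>As a product set, the edges of \<open>D\<close> have one admissible colour and
    all others have two.\<close>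
  have "{c \<in> colourings n. \<forall>e\<in>D. c e = r} = (\<Pi>\<^sub>E e\<in>?E. if e \<in> D then {r} else UNIV)"
    using assms by (auto simp: colourings_def complete_ograph_def PiE_iff extensional_def subset_iff
        split: if_splits)
  then have "card {c \<in> colourings n. \<forall>e\<in>D. c e = r}
      = (\<Prod>e\<in>?E. card (if e \<in> D then {r} else UNIV))"
    by (simp only: card_PiE[OF fin])
  also have "\<dots> = (\<Prod>e\<in>?E - D. 2)"
    using fin assms by (intro prod.mono_neutral_cong_right) (auto simp: UNIV_colour)
  also have "\<dots> = 2 ^ card (?E - D)" by simp
  also have "card (?E - D) = (n choose 2) - card D"
    using fin assms by (simp add: card_Diff_subset finite_subset)
  finally show ?thesis .
qed

text \<open>This is an expectation under a uniformly random colouring, with denominators cleared: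
  each of the \<open>card F * (n choose k)\<close> positions needs colour \<open>r\<close> on
  \<open>q\<close> edges, which has probability \<open>1 / 2 ^ q\<close>.\<close>

lemma sum_card_copies_colourings:
  assumes F: "\<And>H. H \<in> F \<Longrightarrow> verts H = {1..k} \<and> edges H \<subseteq> nsets {1..k} 2 \<and> card (edges H) = q"
    and fin: "finite F"
  shows "(\<Sum>c\<in>colourings n. card (copies F (colour_class n c r))) * 2 ^ q
           \<le> card F * (n choose k) * 2 ^ (n choose 2)"
proof -
  let ?P = "F \<times> nsets {1..n} k"
  have "\<exists>f. strict_mono_on {1..k} f \<and> f ` {1..k} = S" if "S \<in> nsets {1..n} k" for S
    using that obtain_enumeration[of S] unfolding nsets_def by blast
  then obtain en where en: "\<And>S. S \<in> nsets {1..n} k \<Longrightarrow> strict_mono_on {1..k} (en S) \<and> en S ` {1..k} = S"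
    by metis
  \<comment> \<open>The edges that \<open>H\<close> occupies when placed on \<open>S\<close> along
    the increasing enumeration \<open>en S\<close>.\<close>
  define D where "D = (\<lambda>(H, S). (\<lambda>e. en S ` e) ` edges H)"
  have finP: "finite ?P" using fin by (simp add: finite_imp_finite_nsets)
  have D: "D p \<subseteq> nsets {1..n} 2 \<and> card (D p) = q" if "p \<in> ?P" for p
  proof -
    obtain H S where p: "p = (H, S)" "H \<in> F" "S \<in> nsets {1..n} k" using \<open>p \<in> ?P\<close> by auto
    have inj: "inj_on (en S) {1..k}"
      using en[OF p(3)] strict_mono_on_imp_inj_on by blast
    then have "bij_betw (en S) {1..k} S"
      using en[OF p(3)] by (simp add: bij_betw_def)
    from bij_betw_nsets[OF this, of 2] have "(\<lambda>e. en S ` e) ` edges H \<subseteq> nsets S 2"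
      using F[OF p(2)] unfolding bij_betw_def by blast
    moreover have "nsets S 2 \<subseteq> nsets {1..n} 2"
      using p(3) by (intro nsets_mono) (auto simp: nsets_def)
    moreover have "card ((\<lambda>e. en S ` e) ` edges H) = q"
      using F[OF p(2)] inj_on_nsets[OF inj] by (metis card_image inj_on_subset)
    ultimately show ?thesis
      unfolding D_def p(1) by auto
  qed
  have "copies F (colour_class n c r) \<subseteq> {p \<in> ?P. \<forall>e\<in>D p. c e = r}" for c
  proof
    fix p assume p: "p \<in> copies F (colour_class n c r)"
    have "p \<in> ?P"
      using subsetD[OF copies_subset p] F by blast
    from p obtain H f where H: "H \<in> F" and f: "op_copy f H (colour_class n c r)" "p = (H, f ` verts H)"
      by (auto simp: copies_def)
    define S where "S = f ` {1..k}"
    have pS: "p = (H, S)" "S \<in> nsets {1..n} k"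
      using f(2) F[OF H] \<open>p \<in> ?P\<close> by (auto simp: S_def)
    \<comment> \<open>The map of a copy is forced by its image, so the existentially given
      \<open>f\<close> can be replaced by the fixed \<open>en S\<close> that defines
      \<open>D\<close>.\<close>
    have eq: "en S i = f i" if "i \<in> {1..k}" for i
      using en[OF pS(2)] f(1) F[OF H] that
      by (intro enumeration_unique[of k]) (auto simp: S_def op_copy_colour_class_iff)
    have "c (en S ` e) = r" if "e \<in> edges H" for e
    proof -
      have "e \<subseteq> {1..k}" using F[OF H] that by (auto simp: nsets_def)
      then have "en S ` e = f ` e" using eq by (intro image_cong) auto
      then show ?thesis using f(1) that by (simp add: op_copy_colour_class_iff)
    qed
    with \<open>p \<in> ?P\<close> show "p \<in> {p \<in> ?P. \<forall>e\<in>D p. c e = r}"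
      by (auto simp: D_def pS(1))
  qed
  then have "(\<Sum>c\<in>colourings n. card (copies F (colour_class n c r)))
      \<le> (\<Sum>c\<in>colourings n. card {p \<in> ?P. \<forall>e\<in>D p. c e = r})"
    using finP by (intro sum_mono card_mono) auto
  \<comment> \<open>Exchange of summation: every position is monochromatic in colour
    \<open>r\<close> under the same number of colourings.\<close>
  also have "\<dots> = 2 ^ ((n choose 2) - q) * card ?P"
    using finP finite_colourings D card_colourings_constant_on by (intro sum_multicount) auto
  finally have "(\<Sum>c\<in>colourings n. card (copies F (colour_class n c r))) * 2 ^ q
      \<le> card ?P * (2 ^ ((n choose 2) - q) * 2 ^ q)"
    by (simp add: mult_ac)
  also have "\<dots> \<le> card F * (n choose k) * 2 ^ (n choose 2)"
  \<comment> \<open>Subtraction is truncated, so merging the powers requires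
    \<open>q \<le> n choose 2\<close>. Any position supplies this; without positions the left side
    is zero.\<close>
  proof (cases "?P = {}")
    case False
    then obtain p where "p \<in> ?P" by blast
    then have "q \<le> (n choose 2)"
      using D[of p] card_mono[of "nsets {1..n} 2" "D p"] by (auto simp: finite_imp_finite_nsets)
    then show ?thesis
      by (simp add: card_cartesian_product flip: power_add)
  next
    case True
    then show ?thesis by (simp only: card.empty mult_zero_left zero_le)
  qed
  finally show ?thesis .
qed

text \<open>The minimum is at most the average over all \<open>2 ^ (n choose 2)\<close>
  colourings.\<close>

lemma ordered_mult_upper:
  assumes F: "\<And>H. H \<in> F \<union> F' \<Longrightarrow>
      verts H = {1..k} \<and> edges H \<subseteq> nsets {1..k} 2 \<and> card (edges H) = q"
    and fin: "finite F" "finite F'"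
  shows "ordered_mult n F F' * 2 ^ q \<le> (card F + card F') * (n choose k)"
proof -
  have "2 ^ (n choose 2) * ordered_mult n F F' = (\<Sum>c\<in>colourings n. ordered_mult n F F')"
    by (simp add: card_colourings)
  also have "\<dots> \<le> (\<Sum>c\<in>colourings n. mono_copies n F F' c)"
    by (intro sum_mono ordered_mult_le)
  finally have "2 ^ (n choose 2) * ordered_mult n F F' * 2 ^ q
      \<le> (\<Sum>c\<in>colourings n. mono_copies n F F' c) * 2 ^ q"
    by simp
  also have "\<dots> \<le> card F * (n choose k) * 2 ^ (n choose 2) + card F' * (n choose k) * 2 ^ (n choose 2)"
    unfolding mono_copies_def sum.distrib add_mult_distrib
    using F fin by (intro add_mono sum_card_copies_colourings) auto
  also have "\<dots> = 2 ^ (n choose 2) * ((card F + card F') * (n choose k))"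
    by (simp add: algebra_simps)
  finally show ?thesis
    unfolding mult.assoc by (subst (asm) mult_le_cancel1) simp
qed

section \<open>Counting perfect matchings\<close>

lemma perfect_matching_iff:
  "perfect_matching (V, E) \<longleftrightarrow>
     finite V \<and> E \<subseteq> nsets V 2 \<and> (\<forall>v\<in>V. \<exists>!e. e \<in> E \<and> v \<in> e)"
  by (simp add: perfect_matching_def ordered_graph_def)

lemma perfect_matching_disjoint:
  assumes "perfect_matching (V, E)" "e \<in> E" "e' \<in> E" "e \<noteq> e'"
  shows "e \<inter> e' = {}"
  using assms unfolding perfect_matching_iff nsets_def by blast

lemma perfect_matching_remove_edge:
  assumes pm: "perfect_matching (V, E)" and "e \<in> E"
  shows "perfect_matching (V - e, E - {e})"
proof -
  have "E - {e} \<subseteq> nsets (V - e) 2"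
  proof
    fix e' assume e': "e' \<in> E - {e}"
    then have "e' \<inter> e = {}"
      using perfect_matching_disjoint[OF pm] \<open>e \<in> E\<close> by blast
    moreover have "e' \<in> nsets V 2"
      using pm e' by (auto simp: perfect_matching_iff)
    ultimately show "e' \<in> nsets (V - e) 2" by (auto simp: nsets_def)
  qed
  with pm show ?thesis
    unfolding perfect_matching_iff by blast
qed

text \<open>The edges partition \<open>V\<close> into pairs.\<close>

lemma card_perfect_matching_edges:
  assumes pm: "perfect_matching (V, E)"
  shows "2 * card E = card V"
proof -
  have un: "\<Union>E = V"
    using pm by (fastforce simp: perfect_matching_iff nsets_def)
  have "2 * card E = card (\<Union>E)"
  proof (rule card_partition)
    show "finite E"
      using pm by (auto simp: perfect_matching_iff intro: finite_subset finite_imp_finite_nsets)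
    show "finite (\<Union>E)"
      using pm un by (simp add: perfect_matching_iff)
    show "card e = 2" if "e \<in> E" for e
      using pm that by (auto simp: perfect_matching_iff nsets_def)
  qed (use perfect_matching_disjoint[OF pm] in blast)
  with un show ?thesis by simp
qed

lemma finite_perfect_matchings:
  assumes "finite V"
  shows "finite {E. perfect_matching (V, E)}"
  using assms by (auto simp: perfect_matching_iff finite_imp_finite_nsets
      intro: rev_finite_subset[of "Pow (nsets V 2)"])

text \<open>Induction by the partner of a fixed vertex: among \<open>2 * k + 2\<close> vertices it
  has \<open>2 * k + 1\<close> possible partners, and deleting the edge leaves a matching of
  \<open>2 * k\<close> vertices. The bound is the double factorial \<open>(2k - 1)!!\<close>,
  written without division.\<close>

lemma card_perfect_matchings_le:
  assumes "finite V" "card V = 2 * k"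
  shows "card {E. perfect_matching (V, E)} * (2 ^ k * fact k) \<le> (fact (2 * k) :: nat)"
  using assms
proof (induction k arbitrary: V)
  case 0
  then have "{E. perfect_matching (V, E)} = {{}}"
    by (auto simp: perfect_matching_iff nsets_empty_iff)
  then show ?case by simp
next
  case (Suc k)
  then obtain v where v: "v \<in> V" by fastforce
  let ?M = "\<lambda>V. {E. perfect_matching (V, E)}"
  have "?M V \<subseteq> (\<Union>w\<in>V - {v}. insert {v, w} ` ?M (V - {v, w}))"
  proof
    fix E assume "E \<in> ?M V"
    then have pm: "perfect_matching (V, E)" by simp
    then obtain e where e: "e \<in> E" "v \<in> e" "e \<in> nsets V 2"
      using v unfolding perfect_matching_iff by blast
    then obtain w where w: "e = {v, w}" "w \<in> V - {v}"
      by (auto simp: nsets_2_eq)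
    have "E = insert {v, w} (E - {e})" using e w by auto
    moreover have "E - {e} \<in> ?M (V - {v, w})"
      using perfect_matching_remove_edge[OF pm e(1)] w by simp
    ultimately show "E \<in> (\<Union>w\<in>V - {v}. insert {v, w} ` ?M (V - {v, w}))"
      using w(2) by blast
  qed
  then have "card (?M V) \<le> card (\<Union>w\<in>V - {v}. insert {v, w} ` ?M (V - {v, w}))"
    using Suc.prems(1) by (intro card_mono) (auto simp: finite_perfect_matchings)
  also have "\<dots> \<le> (\<Sum>w\<in>V - {v}. card (insert {v, w} ` ?M (V - {v, w})))"
    using Suc.prems(1) by (intro card_UN_le) simp
  also have "\<dots> \<le> (\<Sum>w\<in>V - {v}. card (?M (V - {v, w})))"
    using Suc.prems(1) by (intro sum_mono card_image_le finite_perfect_matchings) simp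
  finally have "card (?M V) * (2 ^ k * fact k)
      \<le> (\<Sum>w\<in>V - {v}. card (?M (V - {v, w})) * (2 ^ k * fact k))"
    by (simp add: sum_distrib_right[symmetric])
  also have "\<dots> \<le> (\<Sum>w\<in>V - {v}. fact (2 * k))"
    using Suc.prems v by (intro sum_mono Suc.IH) (auto simp: card_Diff_subset)
  also have "\<dots> = (2 * k + 1) * fact (2 * k)"
    using Suc.prems v by simp
  \<comment> \<open>The factor \<open>2 * (k + 1)\<close> turns \<open>2 ^ k * fact k\<close> into
    \<open>2 ^ Suc k * fact (Suc k)\<close> and completes the factorial of \<open>2 * Suc k\<close>
    on the right.\<close>
  finally have "(2 * (k + 1)) * (card (?M V) * (2 ^ k * fact k))
      \<le> (2 * (k + 1)) * ((2 * k + 1) * fact (2 * k))"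
    by (rule mult_le_mono2)
  then show ?case
    by (simp add: algebra_simps)
qed

section \<open>The family \<open>B_family m\<close>: shape, size and nonemptiness\<close>

lemma B_familyD:
  assumes "H \<in> B_family m"
  shows "verts H = {1..2 * m} \<and> edges H \<subseteq> nsets {1..2 * m} 2 \<and> card (edges H) = m"
proof -
  have pm: "perfect_matching ({1..2 * m}, edges H)" "verts H = {1..2 * m}"
    using assms by (auto simp: B_family_def) (metis prod.collapse)
  with card_perfect_matching_edges[OF pm(1)] show ?thesis
    by (simp add: perfect_matching_iff)
qed

text \<open>Deleting the prescribed edge leaves a perfect matching of the remaining vertices, from
  which the member is recovered by putting the edge back.\<close>

lemma B_family_subset:
  assumes "m \<ge> 1"
  shows "B_family m \<subseteq> (\<lambda>E. ({1..2 * m}, insert {1, 2 * m} E)) `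
           {E. perfect_matching ({1..2 * m} - {1, 2 * m}, E)}"
proof
  fix H assume "H \<in> B_family m"
  then obtain E where H: "H = ({1..2 * m}, E)" "perfect_matching ({1..2 * m}, E)" "{1, 2 * m} \<in> E"
    by (cases H) (auto simp: B_family_def)
  from perfect_matching_remove_edge[OF H(2,3)] H(1,3)
  show "H \<in> (\<lambda>E. ({1..2 * m}, insert {1, 2 * m} E)) `
           {E. perfect_matching ({1..2 * m} - {1, 2 * m}, E)}"
    by (intro image_eqI[of _ _ "E - {{1, 2 * m}}"]) auto
qed

lemma finite_B_family:
  assumes "m \<ge> 1"
  shows "finite (B_family m)"
  by (rule finite_subset[OF B_family_subset[OF assms]]) (simp add: finite_perfect_matchings)

lemma card_B_family_le:
  assumes "m \<ge> 1"
  shows "card (B_family m) * (2 ^ (m - 1) * fact (m - 1)) \<le> (fact (2 * m - 2) :: nat)"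
proof -
  let ?V = "{1..2 * m} - {1, 2 * m}"
  have "card (B_family m) \<le> card {E. perfect_matching (?V, E)}"
    by (rule surj_card_le[OF _ B_family_subset[OF assms]]) (simp add: finite_perfect_matchings)
  then have "card (B_family m) * (2 ^ (m - 1) * fact (m - 1))
      \<le> card {E. perfect_matching (?V, E)} * (2 ^ (m - 1) * fact (m - 1))"
    by (rule mult_le_mono1)
  also have "\<dots> \<le> fact (2 * (m - 1))"
    using assms by (intro card_perfect_matchings_le) (auto simp: card_Diff_subset)
  finally show ?thesis
    by (simp add: diff_mult_distrib2)
qed

lemma B_family_nonempty:
  assumes "m \<ge> 1"
  shows "B_family m \<noteq> {}"
proof -
  \<comment> \<open>The nested matching, whose outermost edge (\<open>i = 1\<close>) is the
    prescribed one.\<close>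
  define E where "E = (\<lambda>i. {i, 2 * m + 1 - i}) ` {1..m}"
  have "E \<subseteq> nsets {1..2 * m} 2"
    by (auto simp: E_def)
  moreover have "\<exists>!e. e \<in> E \<and> v \<in> e" if v: "v \<in> {1..2 * m}" for v
  proof (rule ex1I)
    show "{v, 2 * m + 1 - v} \<in> E \<and> v \<in> {v, 2 * m + 1 - v}"
    proof (cases "v \<le> m")
      case True
      then show ?thesis using v by (auto simp: E_def)
    next
      case False
      \<comment> \<open>A vertex in the upper half is covered by the edge indexed by its mirror
        image.\<close>
      then have "{v, 2 * m + 1 - v} = {2 * m + 1 - v, 2 * m + 1 - (2 * m + 1 - v)}"
        "2 * m + 1 - v \<in> {1..m}"
        using v by auto
      then show ?thesis unfolding E_def by blast
    qed
    show "e = {v, 2 * m + 1 - v}" if "e \<in> E \<and> v \<in> e" for e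
      using that by (auto simp: E_def)
  qed
  moreover have "{1, 2 * m} \<in> E"
    using assms by (auto simp: E_def intro!: image_eqI[of _ _ 1])
  ultimately have "({1..2 * m}, E) \<in> B_family m"
    by (simp add: B_family_def perfect_matching_iff)
  then show ?thesis by blast
qed

section \<open>The ordered Ramsey number\<close>

text \<open>Ramsey's theorem gives a monochromatic clique on \<open>k\<close> vertices, and its
  increasing enumeration embeds every graph on \<open>{1..k}\<close>.\<close>

lemma ordered_Ramsey_exists:
  fixes F :: "nat ograph set"
  assumes H: "H \<in> F" "verts H = {1..k}" "edges H \<subseteq> nsets {1..k} 2"
  shows "\<exists>N. \<forall>c\<in>colourings N. \<exists>r. \<exists>H\<in>F. \<exists>f. op_copy f H (colour_class N c r)"
proof -
  obtain N :: nat where N: "partn_lst {..<N} [k, k] 2"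
    using ramsey_full by blast
  have "\<exists>r. \<exists>f. op_copy f H (colour_class N c r)" for c
  proof -
    \<comment> \<open>Ramsey's theorem is applied on \<open>{..<N}\<close> with colours 0 and 1;
      \<open>Suc\<close> moves its vertices to \<open>{1..N}\<close>.\<close>
    define d :: "nat set \<Rightarrow> nat" where "d e = (case c (Suc ` e) of Red \<Rightarrow> 0 | Blue \<Rightarrow> 1)" for e
    have "d \<in> nsets {..<N} 2 \<rightarrow> {..<2}"
      by (auto simp: d_def split: colour.split)
    then obtain i X where X: "i < 2" "X \<in> nsets {..<N} ([k, k] ! i)" "d ` nsets X 2 \<subseteq> {i}"
      using partn_lstE[OF N] by (metis length_Cons list.size(3) numeral_2_eq_2)
    have X': "X \<subseteq> {..<N}" "finite X" "card X = k"
      using X(1,2) by (auto simp: nsets_def less_2_cases_iff)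
    define r where "r = (if i = 0 then Red else Blue)"
    have cr: "c (Suc ` e) = r" if "e \<in> nsets X 2" for e
      using X(3) that by (auto simp: d_def r_def split: colour.splits)
    obtain g where g: "strict_mono_on {1..k} g" "g ` {1..k} = X"
      using obtain_enumeration[OF X'(2)] X'(3) by metis
    have bij: "bij_betw g {1..k} X"
      using g strict_mono_on_imp_inj_on by (auto simp: bij_betw_def)
    have "op_copy (Suc \<circ> g) H (colour_class N c r)"
      unfolding op_copy_colour_class_iff
    proof (intro conjI ballI)
      show "(Suc \<circ> g) ` verts H \<subseteq> {1..N}"
        using g(2) X'(1) H(2) by (auto simp: image_comp[symmetric])
      show "strict_mono_on (verts H) (Suc \<circ> g)"
        using g(1) H(2) by (auto simp: strict_mono_on_def)
      fix e assume "e \<in> edges H"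
      then have ge: "g ` e \<in> nsets X 2"
        using bij_betw_nsets[OF bij, of 2] H(3) unfolding bij_betw_def by blast
      then show "c ((Suc \<circ> g) ` e) = r"
        using cr unfolding image_comp[symmetric] by blast
      show "(Suc \<circ> g) ` e \<in> nsets {1..N} 2"
        using ge X'(1) unfolding image_comp[symmetric]
        by (fastforce simp: nsets_def card_image)
    qed
    then show ?thesis by blast
  qed
  with H(1) show ?thesis by blast
qed

text \<open>A \<open>LEAST\<close> has the defining property only once some number is known to have
  it, which Ramsey's theorem ensures.\<close>

lemma ordered_Ramsey_copy:
  assumes "H \<in> F" "verts H = {1..k}" "edges H \<subseteq> nsets {1..k} 2"
    and "c \<in> colourings (ordered_Ramsey F)"
  shows "\<exists>r. \<exists>H\<in>F. \<exists>f. op_copy f H (colour_class (ordered_Ramsey F) c r)"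
  using LeastI_ex[OF ordered_Ramsey_exists[OF assms(1-3)]] assms(4)
  unfolding ordered_Ramsey_def by blast

text \<open>Any colouring on that many vertices contains a copy, which injects \<open>k\<close>
  vertices. This keeps the binomial denominators positive from the Ramsey number on.\<close>

lemma ordered_Ramsey_ge:
  assumes F: "\<And>H. H \<in> F \<Longrightarrow> verts H = {1..k} \<and> edges H \<subseteq> nsets {1..k} 2" and "F \<noteq> {}"
  shows "k \<le> ordered_Ramsey F"
proof -
  let ?R = "ordered_Ramsey F"
  obtain c where "c \<in> colourings ?R" using colourings_nonempty by blast
  then obtain r H f where "H \<in> F" "op_copy f H (colour_class ?R c r)"
    using ordered_Ramsey_copy F \<open>F \<noteq> {}\<close> by (metis ex_in_conv)
  with F have "f ` {1..k} \<subseteq> {1..?R}" "inj_on f {1..k}"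
    by (auto simp: op_copy_colour_class_iff strict_mono_on_imp_inj_on)
  then show ?thesis
    using card_inj_on_le[of f "{1..k}" "{1..?R}"] by simp
qed

lemma ordered_mult_ordered_Ramsey_pos:
  assumes F: "\<And>H. H \<in> F \<Longrightarrow> verts H = {1..k} \<and> edges H \<subseteq> nsets {1..k} 2" and "F \<noteq> {}" "finite F"
  shows "0 < ordered_mult (ordered_Ramsey F) F F"
proof -
  let ?R = "ordered_Ramsey F"
  obtain c where c: "c \<in> colourings ?R" "ordered_mult ?R F F = mono_copies ?R F F c"
    by (rule ordered_mult_attained)
  obtain r H f where "H \<in> F" "op_copy f H (colour_class ?R c r)"
    using ordered_Ramsey_copy F \<open>F \<noteq> {}\<close> c(1) by (metis ex_in_conv)
  then have "(H, f ` verts H) \<in> copies F (colour_class ?R c r)"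
    by (auto simp: copies_def)
  moreover have "finite (copies F (colour_class ?R c r))"
    using F \<open>finite F\<close>
    by (intro finite_subset[OF copies_subset[of F k]]) (auto simp: finite_imp_finite_nsets)
  ultimately have "0 < card (copies F (colour_class ?R c r))"
    by (auto simp: card_gt_0_iff)
  then show ?thesis
    unfolding c(2) mono_copies_def by (cases r) auto
qed

section \<open>Limit density and growth rate\<close>

theorem theorem4p3:
  fixes m :: nat
  assumes "m \<ge> 1"
  shows "(\<forall>t n. ordered_Ramsey (B_family m) \<le> t \<and> t \<le> n \<longrightarrow>
            real (ordered_mult n (B_family m) (B_family m))
              \<ge> real (ordered_mult t (B_family m) (B_family m))
                  * (real (n choose (2*m)) / real (t choose (2*m))))
       \<and> (\<forall>n. real (ordered_mult n (B_family m) (B_family m))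
              \<le> real (n choose (2*m)) * (fact (2*m - 2) / (2 ^ (2*m - 2) * fact (m - 1))))
       \<and> mono_on {ordered_Ramsey (B_family m)..}
            (\<lambda>n. real (ordered_mult n (B_family m) (B_family m)) / real (n choose (2*m)))
       \<and> (\<exists>\<pi>::real.
            (\<lambda>n. real (ordered_mult n (B_family m) (B_family m)) / real (n choose (2*m)))
              \<longlonglongrightarrow> \<pi>
          \<and> real (ordered_mult (ordered_Ramsey (B_family m)) (B_family m) (B_family m))
                / real (ordered_Ramsey (B_family m) choose (2*m)) \<le> \<pi>
          \<and> \<pi> \<le> fact (2*m - 2) / (2 ^ (2*m - 2) * fact (m - 1)))
       \<and> (\<lambda>n. real (ordered_mult n (B_family m) (B_family m))) \<in> \<Theta>(\<lambda>n. real n ^ (2*m))"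
proof -
  define B where "B = B_family m"
  define R where "R = ordered_Ramsey B"
  define M where "M n = ordered_mult n B B" for n
  define u :: real where "u = fact (2*m - 2) / (2 ^ (2*m - 2) * fact (m - 1))"
  define d where "d n = real (M n) / real (n choose (2*m))" for n
  have B: "\<And>H. H \<in> B \<union> B \<Longrightarrow> verts H = {1..2*m} \<and> edges H \<subseteq> nsets {1..2*m} 2 \<and> card (edges H) = m"
    and finB: "finite B" and neB: "B \<noteq> {}"
    using B_familyD finite_B_family B_family_nonempty assms unfolding B_def by auto
  have kR: "2*m \<le> R"
    unfolding R_def using B neB by (intro ordered_Ramsey_ge) auto
  have pos: "0 < real (n choose (2*m))" if "R \<le> n" for n
    using that kR by simp
  have mono: "d t \<le> d n" if "R \<le> t" "t \<le> n" for t n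
    unfolding d_def M_def using that kR B finB by (intro ordered_mult_density_mono) auto
  have upper: "real (M n) \<le> real (n choose (2*m)) * u" for n
  proof -
    obtain j where j: "m = Suc j" using assms by (cases m) auto
    have "real (M n) * 2 ^ m \<le> 2 * real (card B) * real (n choose (2*m))"
      using of_nat_mono[OF ordered_mult_upper[OF B finB finB, of n], where 'a = real]
      unfolding M_def by simp
    \<comment> \<open>The two choices of colour absorb one of the \<open>m\<close> halvings, leaving
      \<open>j = m - 1\<close>.\<close>
    then have "real (M n) * 2 ^ j \<le> real (card B) * real (n choose (2*m))"
      by (simp add: j)
    then have "real (M n) \<le> real (n choose (2*m)) * (real (card B) / 2 ^ j)"
      by (simp add: field_simps)
    also have "real (card B) / 2 ^ j \<le> u"
    proof -
      have "real (card B * (2 ^ j * fact j)) \<le> real (fact (2 * j))"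
        using card_B_family_le[OF assms] unfolding B_def j by (intro of_nat_mono) simp
      then have "real (card B) \<le> fact (2 * j) / (2 ^ j * fact j)"
        by (simp add: pos_le_divide_eq)
      \<comment> \<open>The size of \<open>B\<close> contributes one factor \<open>2 ^ j\<close> to
        the denominator and the colouring average another; together they are
        \<open>2 ^ (2*m - 2)\<close>.\<close>
      from divide_right_mono[OF this, of "2 ^ j"] show ?thesis
        unfolding u_def j by (simp add: mult_2 mult_2_right power_add mult_ac)
    qed
    finally show ?thesis by (simp add: mult_left_mono)
  qed
  have upper': "d n \<le> u" if "R \<le> n" for n
    using upper[of n] pos[OF that] by (simp add: d_def field_simps)
  \<comment> \<open>The shift by \<open>R\<close> keeps to the range where \<open>mono\<close> and
    \<open>upper'\<close> apply; \<open>LIMSEQ_offset\<close> removes it from the limit.\<close>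
  have "incseq (\<lambda>n. d (n + R))"
    using mono by (simp add: incseq_def)
  then obtain p where p: "(\<lambda>n. d (n + R)) \<longlonglongrightarrow> p" "\<forall>n. d (n + R) \<le> p"
    by (rule incseq_convergent[where B = u]) (use upper' in auto)
  have lim: "d \<longlonglongrightarrow> p"
    using p(1) by (rule LIMSEQ_offset)
  have p_ge: "d R \<le> p"
    using p(2)[rule_format, of 0] by simp
  have p_le: "p \<le> u"
    using p(1) upper' by (intro LIMSEQ_le_const2[OF p(1)]) auto
  have "0 < d R"
    using ordered_mult_ordered_Ramsey_pos[of B "2*m"] B neB finB pos[of R]
    by (auto simp: d_def M_def R_def)
  \<comment> \<open>For \<open>n \<ge> R\<close>, \<open>d n \<ge> d R\<close> and
    \<open>n choose (2*m)\<close> is at least \<open>(n / (2*m)) ^ (2*m)\<close>, so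
    \<open>a\<close> is the constant of the lower growth bound.\<close>
  define a where "a = d R / real (2*m) ^ (2*m)"
  have "a > 0" using \<open>0 < d R\<close> assms by (simp add: a_def)
  have "u > 0" by (simp add: u_def)
  have theta: "(\<lambda>n. real (M n)) \<in> \<Theta>(\<lambda>n. real n ^ (2*m))"
  proof (rule bigthetaI)
    have "real (M n) \<le> u * real n ^ (2*m)" if "R \<le> n" for n
    proof -
      have "real (n choose (2*m)) \<le> real (n ^ (2*m))"
        using that kR by (intro of_nat_mono binomial_le_pow) simp
      with \<open>u > 0\<close> have "real (n choose (2*m)) * u \<le> real n ^ (2*m) * u"
        by (intro mult_right_mono) auto
      with upper[of n] show ?thesis by (simp add: mult.commute)
    qed
    then show "(\<lambda>n. real (M n)) \<in> O(\<lambda>n. real n ^ (2*m))"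
      by (intro bigoI[of _ u] eventually_mono[OF eventually_ge_at_top[of R]]) simp
    have "a * real n ^ (2*m) \<le> real (M n)" if "R \<le> n" for n
    proof -
      have "a * real n ^ (2*m) = d R * (real n / real (2*m)) ^ (2*m)"
        by (simp add: a_def power_divide)
      also have "\<dots> \<le> d n * real (n choose (2*m))"
        using that kR \<open>0 < d R\<close> mono[of R n]
        by (intro mult_mono binomial_ge_n_over_k_pow_k) auto
      also have "\<dots> = real (M n)"
        using pos[OF that] by (simp add: d_def)
      finally show ?thesis .
    qed
    then show "(\<lambda>n. real (M n)) \<in> \<Omega>(\<lambda>n. real n ^ (2*m))"
      using \<open>a > 0\<close>
      by (intro landau_omega.bigI[of a] eventually_mono[OF eventually_ge_at_top[of R]]) simp_all
  qed
  have ineq: "real (M n) \<ge> real (M t) * (real (n choose (2*m)) / real (t choose (2*m)))"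
    if "R \<le> t" "t \<le> n" for t n
    using mono[OF that] pos[OF that(1)] pos[of n] that by (simp add: d_def field_simps)
  have mono': "mono_on {R..} d"
    using mono by (auto intro: mono_onI)
  show ?thesis
    using ineq upper mono' lim p_ge p_le theta
    unfolding B_def[symmetric] R_def[symmetric] M_def[symmetric] u_def[symmetric] d_def[symmetric]
    by blast
qed

end
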